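(* Let $H$ be a graph such that $I_{K_3\to H}$ is normal. Then for every maximal outerplanar graph $G$, the ideal $I_{G\to H}$ is normal.
   Context: Graphs are finite and undirected without multiple edges; loops are allowed in general (in particular in $H$). $\mathrm{Hom}(G,H)$ is the set of graph homomorphisms, i.e. maps $\phi:V(G)\to V(H)$ with $\phi(u)\phi(v)\in E(H)$ whenever $uv\in E(G)$. Fix a field $\mathbf{k}$. For $e\in E(G)$ let $G[e]$ be the subgraph consisting only of $e$ and its endpoint(s). Put $R_{G\to H}=\mathbf{k}[r_\phi : \phi\in\mathrm{Hom}(G,H)]$ and $S_{G\to H}=\mathbf{k}[s_\psi : e\in E(G),\ \psi\in \mathrm{Hom}(G[e],H)]$. Let $\Phi_{G\to H}:R_{G\to H}\to S_{G\to H}$ be the $\mathbf{k}$-algebra map with $\Phi(r_\phi)=\prod_{e\in E(G)} s_{\phi|_e}$, and $I_{G\to H}=\ker\Phi_{G\to H}$. The semigroup associated to $I_{G\to H}$ is the affine semigroup $Q$ (with $0$) generated by the exponent vectors of the monomials $\Phi(r_\phi)$, $\phi\in\mathrm{Hom}(G,H)$. It is normal if every $q$ in the group generated by $Q$ with $nq\in Q$ for some integer $n\ge1$ lies in $Q$; "the ideal $I_{G\to H}$ is normal" means that its associated semigroup is normal. An outerplanar graph is a (loopless) graph that can be drawn in the plane with straight edges and with its vertices on a circle without any edges crossing each other; a maximal outerplanar graph is thus (the graph of) a triangulation of an $n$-gon. $K_3$ is the triangle. *)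

theory Defs
  imports
    "HOL-Analysis.Analysis"
    "HOL-Computational_Algebra.Group_Closure"
    "HOL-Library.Poly_Mapping"
begin

section \<open>Graphs and homomorphisms\<close>

text \<open>A non-loop edge is a two-element set of vertices, a loop at \<open>v\<close> is the singleton \<open>{v}\<close>.\<close>

record 'a graph =
  vertices :: "'a set"
  edges :: "'a set set"

definition is_graph :: "'a graph \<Rightarrow> bool" where
  "is_graph G \<longleftrightarrow> finite (vertices G) \<and>
     (\<forall>e\<in>edges G. e \<subseteq> vertices G \<and> (card e = 1 \<or> card e = 2))"

definition loopless :: "'a graph \<Rightarrow> bool" where
  "loopless G \<longleftrightarrow> (\<forall>e\<in>edges G. card e \<noteq> 1)"

text \<open>For \<open>e = {u, v}\<close> the image \<open>\<phi> ` e\<close> is \<open>{\<phi> u, \<phi> v}\<close>, a loop if \<open>\<phi> u = \<phi> v\<close>.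
  Homomorphisms are extensional, so that they are determined by their values on \<open>vertices G\<close>.\<close>

definition Hom :: "'a graph \<Rightarrow> 'b graph \<Rightarrow> ('a \<Rightarrow> 'b) set" where
  "Hom G H = {\<phi> \<in> vertices G \<rightarrow>\<^sub>E vertices H. \<forall>e\<in>edges G. \<phi> ` e \<in> edges H}"

definition edge_subgraph :: "'a set \<Rightarrow> 'a graph" where
  "edge_subgraph e = \<lparr>vertices = e, edges = {e}\<rparr>"

definition complete_graph :: "'a set \<Rightarrow> 'a graph" where
  "complete_graph V = \<lparr>vertices = V, edges = {e. e \<subseteq> V \<and> card e = 2}\<rparr>"

abbreviation K3 :: "nat graph" where
  "K3 \<equiv> complete_graph {0, 1, 2}"


section \<open>Maximal outerplanar graphs\<close>

text \<open>Edges are drawn as segments \<open>convex hull (f ` e)\<close>; two distinct edges may meet only in the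
  image of a common endpoint.\<close>

definition outerplanar :: "'a graph \<Rightarrow> bool" where
  "outerplanar G \<longleftrightarrow> is_graph G \<and> loopless G \<and>
     (\<exists>(f :: 'a \<Rightarrow> complex) c r. r > 0 \<and> inj_on f (vertices G) \<and> f ` vertices G \<subseteq> sphere c r \<and>
        (\<forall>e\<in>edges G. \<forall>e'\<in>edges G. e \<noteq> e' \<longrightarrow>
           convex hull (f ` e) \<inter> convex hull (f ` e') \<subseteq> f ` (e \<inter> e')))"

definition maximal_outerplanar :: "'a graph \<Rightarrow> bool" where
  "maximal_outerplanar G \<longleftrightarrow> outerplanar G \<and>
     (\<forall>G' :: 'a graph. outerplanar G' \<and> vertices G' = vertices G \<and> edges G \<subseteq> edges G' \<longrightarrow>
        edges G' = edges G)"


section \<open>The ideal of graph homomorphisms\<close>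

text \<open>\<open>('x, 'k) mpoly\<close> is the polynomial ring over \<open>'k\<close> with one indeterminate for each element
  of \<open>'x\<close>: a polynomial maps exponent vectors to coefficients, and the product is convolution.\<close>

type_synonym ('x, 'k) mpoly = "('x \<Rightarrow>\<^sub>0 nat) \<Rightarrow>\<^sub>0 'k"

definition indet :: "'x \<Rightarrow> ('x, 'k :: comm_ring_1) mpoly" where
  "indet x = Poly_Mapping.single (Poly_Mapping.single x 1) 1"

text \<open>The \<open>'k\<close>-algebra homomorphism sending \<open>indet x\<close> to \<open>f x\<close>.\<close>

definition alg_hom :: "('x \<Rightarrow> ('y, 'k :: comm_ring_1) mpoly) \<Rightarrow> ('x, 'k) mpoly \<Rightarrow> ('y, 'k) mpoly" where
  "alg_hom f p = (\<Sum>m\<in>Poly_Mapping.keys p. Poly_Mapping.single 0 (Poly_Mapping.lookup p m) *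
     (\<Prod>x\<in>Poly_Mapping.keys m. f x ^ Poly_Mapping.lookup m x))"

definition poly_ring :: "'x set \<Rightarrow> ('x, 'k :: comm_ring_1) mpoly set" where
  "poly_ring X = {p. \<forall>m\<in>Poly_Mapping.keys p. Poly_Mapping.keys m \<subseteq> X}"

text \<open>The indeterminate \<open>s\<^sub>\<psi>\<close> with \<open>\<psi> \<in> Hom (edge_subgraph e) H\<close> is indexed by the pair \<open>(e, \<psi>)\<close>.\<close>

definition R_vars :: "'a graph \<Rightarrow> 'b graph \<Rightarrow> ('a \<Rightarrow> 'b) set" where
  "R_vars G H = Hom G H"

definition S_vars :: "'a graph \<Rightarrow> 'b graph \<Rightarrow> ('a set \<times> ('a \<Rightarrow> 'b)) set" where
  "S_vars G H = (SIGMA e : edges G. Hom (edge_subgraph e) H)"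

definition hom_map ::
  "'a graph \<Rightarrow> ('a \<Rightarrow> 'b, 'k :: field) mpoly \<Rightarrow> ('a set \<times> ('a \<Rightarrow> 'b), 'k) mpoly" where
  "hom_map G = alg_hom (\<lambda>\<phi>. \<Prod>e\<in>edges G. indet (e, restrict \<phi> e))"

definition hom_ideal :: "'a graph \<Rightarrow> 'b graph \<Rightarrow> ('a \<Rightarrow> 'b, 'k :: field) mpoly set" where
  "hom_ideal G H = {p \<in> poly_ring (R_vars G H). hom_map G p = 0}"

lemma restrict_in_S_vars:
  assumes "is_graph G" "\<phi> \<in> R_vars G H" "e \<in> edges G"
  shows "(e, restrict \<phi> e) \<in> S_vars G H"
  using assms by (auto simp: S_vars_def R_vars_def Hom_def edge_subgraph_def is_graph_def)

lemma hom_map_indet: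
  "hom_map G (indet \<phi> :: (_, 'k :: field) mpoly) = (\<Prod>e\<in>edges G. indet (e, restrict \<phi> e))"
  by (simp add: hom_map_def alg_hom_def indet_def)


section \<open>Normality\<close>

inductive_set monoid_closure :: "'a :: comm_monoid_add set \<Rightarrow> 'a set" for A where
  zero: "0 \<in> monoid_closure A"
| base: "a \<in> A \<Longrightarrow> a \<in> monoid_closure A"
| add: "a \<in> monoid_closure A \<Longrightarrow> b \<in> monoid_closure A \<Longrightarrow> a + b \<in> monoid_closure A"

text \<open>Scaling of an integer vector is \<open>frag_cmul\<close>.\<close>

definition normal_semigroup :: "('x \<Rightarrow>\<^sub>0 int) set \<Rightarrow> bool" where
  "normal_semigroup Q \<longleftrightarrow>
     (\<forall>q\<in>group_closure Q. \<forall>n\<ge>1. frag_cmul n q \<in> Q \<longrightarrow> q \<in> Q)"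

text \<open>The exponent vectors of the monomials \<open>hom_map G (indet \<phi>)\<close>, regarded as integer vectors.
  The type argument is the field of coefficients.\<close>

definition hom_exponents ::
  "'k :: field itself \<Rightarrow> 'a graph \<Rightarrow> 'b graph \<Rightarrow> (('a set \<times> ('a \<Rightarrow> 'b)) \<Rightarrow>\<^sub>0 int) set" where
  "hom_exponents _ G H =
     {Poly_Mapping.map int m | m \<phi>. \<phi> \<in> R_vars G H \<and>
        hom_map G (indet \<phi>) = Poly_Mapping.single m (1 :: 'k)}"

definition hom_semigroup ::
  "'k :: field itself \<Rightarrow> 'a graph \<Rightarrow> 'b graph \<Rightarrow> (('a set \<times> ('a \<Rightarrow> 'b)) \<Rightarrow>\<^sub>0 int) set" where
  "hom_semigroup K G H = monoid_closure (hom_exponents K G H)"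

text \<open>Normality of the ideal \<open>hom_ideal G H\<close> is by definition normality of its associated semigroup.\<close>

definition hom_ideal_normal :: "'k :: field itself \<Rightarrow> 'a graph \<Rightarrow> 'b graph \<Rightarrow> bool" where
  "hom_ideal_normal K G H \<longleftrightarrow> normal_semigroup (hom_semigroup K G H)"

end

theory Submission
  imports Defs
begin

text \<open>Measuring vertices of an outerplanar drawing by their angle on the circle, two chords cross iff
  their ends interleave. Hence, by maximality, every edge with a vertex strictly between its ends spans
  a triangle with one of them, and a maximal outerplanar graph with an edge is built from single edges
  and triangles by gluing along common edges.

  A semigroup element is determined by the multisets of colourings that it puts on the edges of \<open>G\<close>.
  It splits into homomorphisms on every triangle by the hypothesis on \<open>K\<^sub>3\<close>. If it splits on two pieces
  with a common edge, the two families of homomorphisms induce the same multiset of colourings of that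
  edge, so their members can be paired up and glued.\<close>

section \<open>Normality in terms of multisets of homomorphisms\<close>

definition edge_types :: "('a \<Rightarrow> 'b) multiset \<Rightarrow> 'a set \<Rightarrow> ('a \<Rightarrow> 'b) multiset" where
  "edge_types A e = {#restrict \<phi> e. \<phi> \<in># A#}"

lemma edge_types_simps [simp]:
  "edge_types {#} e = {#}"
  "edge_types (add_mset \<phi> A) e = add_mset (restrict \<phi> e) (edge_types A e)"
  "edge_types (A + B) e = edge_types A e + edge_types B e"
  "edge_types (repeat_mset n A) e = repeat_mset n (edge_types A e)"
proof -
  show "edge_types (repeat_mset n A) e = repeat_mset n (edge_types A e)"
    by (induction n) (simp_all add: edge_types_def)
qed (simp_all add: edge_types_def)

lemma edge_types_restrict:
  assumes "e \<subseteq> W"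
  shows "edge_types {#restrict (f \<phi>) W. \<phi> \<in># A#} e = edge_types {#f \<phi>. \<phi> \<in># A#} e"
  using assms by (simp add: edge_types_def multiset.map_comp comp_def Int_absorb1)

lemma edge_types_comp:
  "edge_types {#\<phi> \<circ> f. \<phi> \<in># A#} e = {#restrict (\<xi> \<circ> f) e. \<xi> \<in># edge_types A (f ` e)#}"
  by (simp add: edge_types_def multiset.map_comp comp_def) (auto intro!: image_mset_cong)


definition hom_vector :: "'a graph \<Rightarrow> ('a \<Rightarrow> 'b) \<Rightarrow> ('a set \<times> ('a \<Rightarrow> 'b)) \<Rightarrow>\<^sub>0 int" where
  "hom_vector G \<phi> = (\<Sum>e\<in>edges G. frag_of (e, restrict \<phi> e))"

definition hom_sum :: "'a graph \<Rightarrow> ('a \<Rightarrow> 'b) multiset \<Rightarrow> ('a set \<times> ('a \<Rightarrow> 'b)) \<Rightarrow>\<^sub>0 int" where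
  "hom_sum G A = (\<Sum>\<phi>\<in>#A. hom_vector G \<phi>)"

lemma hom_sum_simps [simp]:
  "hom_sum G {#} = 0"
  "hom_sum G (add_mset \<phi> A) = hom_vector G \<phi> + hom_sum G A"
  "hom_sum G (A + B) = hom_sum G A + hom_sum G B"
  by (simp_all add: hom_sum_def)

lemma hom_sum_repeat [simp]: "hom_sum G (repeat_mset n A) = frag_cmul (int n) (hom_sum G A)"
  by (induction n) (simp_all add: frag_cmul_distrib)

lemma finite_edges: "is_graph G \<Longrightarrow> finite (edges G)"
  by (rule finite_subset[of _ "Pow (vertices G)"]) (auto simp: is_graph_def)

lemma prod_indet:
  assumes "finite X"
  shows "(\<Prod>x\<in>X. indet (f x) :: (_, 'k :: comm_ring_1) mpoly)
    = Poly_Mapping.single (\<Sum>x\<in>X. Poly_Mapping.single (f x) 1) 1"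
  using assms by induction (simp_all add: indet_def mult_single)

lemma hom_exponents_eq:
  assumes "is_graph G"
  shows "hom_exponents TYPE('k :: field) G H = hom_vector G ` Hom G H"
proof -
  have map: "Poly_Mapping.map int (\<Sum>e\<in>edges G. Poly_Mapping.single (e, restrict \<phi> e) 1)
      = hom_vector G \<phi>" for \<phi> :: "'a \<Rightarrow> 'b"
  proof (rule poly_mapping_eqI)
    fix k
    have "Poly_Mapping.lookup (Poly_Mapping.map int p) k = int (Poly_Mapping.lookup p k)"
      for p :: "('a set \<times> ('a \<Rightarrow> 'b)) \<Rightarrow>\<^sub>0 nat"
      by (simp add: Poly_Mapping.map.rep_eq when_def)
    then show "Poly_Mapping.lookup (Poly_Mapping.map int
        (\<Sum>e\<in>edges G. Poly_Mapping.single (e, restrict \<phi> e) 1)) k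
        = Poly_Mapping.lookup (hom_vector G \<phi>) k"
      by (auto simp: hom_vector_def lookup_sum lookup_single when_def intro!: sum.cong)
  qed
  have single_eq: "Poly_Mapping.single m (1 :: 'k) = Poly_Mapping.single m' 1 \<longleftrightarrow> m = m'"
    for m m' :: "('a set \<times> ('a \<Rightarrow> 'b)) \<Rightarrow>\<^sub>0 nat"
    by (metis lookup_single_eq lookup_single_not_eq zero_neq_one)
  show ?thesis
    unfolding hom_exponents_def R_vars_def hom_map_indet prod_indet[OF finite_edges[OF assms]]
      single_eq by (auto simp del: One_nat_def simp: map[symmetric])
qed

lemma lookup_hom_sum:
  assumes "is_graph G"
  shows "Poly_Mapping.lookup (hom_sum G A) (e, \<xi>)
    = (if e \<in> edges G then int (count (edge_types A e) \<xi>) else 0)"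
proof (induction A)
  case (add \<phi> A)
  have "Poly_Mapping.lookup (hom_vector G \<phi>) (e, \<xi>)
      = (\<Sum>e'\<in>edges G. if e' = e then if \<xi> = restrict \<phi> e then 1 else 0 else 0)"
    unfolding hom_vector_def lookup_sum by (intro sum.cong) auto
  then show ?case using add finite_edges[OF assms] by (auto simp: lookup_add)
qed simp

lemma hom_sum_eq_iff:
  assumes "is_graph G"
  shows "hom_sum G A = hom_sum G B \<longleftrightarrow> (\<forall>e\<in>edges G. edge_types A e = edge_types B e)"
proof
  assume eq: "hom_sum G A = hom_sum G B"
  show "\<forall>e\<in>edges G. edge_types A e = edge_types B e"
  proof (intro ballI multiset_eqI)
    fix e \<xi> assume "e \<in> edges G"
    then show "count (edge_types A e) \<xi> = count (edge_types B e) \<xi>"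
      using lookup_hom_sum[OF assms, of A e \<xi>] lookup_hom_sum[OF assms, of B e \<xi>] eq by simp
  qed
next
  assume *: "\<forall>e\<in>edges G. edge_types A e = edge_types B e"
  show "hom_sum G A = hom_sum G B"
  proof (rule poly_mapping_eqI)
    fix k :: "'a set \<times> ('a \<Rightarrow> 'b)"
    show "Poly_Mapping.lookup (hom_sum G A) k = Poly_Mapping.lookup (hom_sum G B) k"
      using * by (cases k) (simp add: lookup_hom_sum[OF assms])
  qed
qed

lemma hom_semigroup_eq:
  assumes "is_graph G"
  shows "hom_semigroup TYPE('k :: field) G H = hom_sum G ` {A. set_mset A \<subseteq> Hom G H}"
    (is "?L = ?R")
proof
  show "?L \<subseteq> ?R"
  proof
    fix x assume "x \<in> ?L"
    then have "x \<in> monoid_closure (hom_vector G ` Hom G H)"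
      by (simp add: hom_semigroup_def hom_exponents_eq[OF assms])
    then show "x \<in> ?R"
    proof induction
      case zero
      show ?case by (rule image_eqI[of _ _ "{#}"]) auto
    next
      case (base a)
      then obtain \<phi> where "\<phi> \<in> Hom G H" "a = hom_vector G \<phi>" by auto
      then show ?case by (intro image_eqI[of _ _ "{#\<phi>#}"]) auto
    next
      case (add a b)
      then obtain A B where "set_mset A \<subseteq> Hom G H" "a = hom_sum G A"
        "set_mset B \<subseteq> Hom G H" "b = hom_sum G B" by auto
      then show ?case by (intro image_eqI[of _ _ "A + B"]) auto
    qed
  qed
next
  have "hom_sum G A \<in> monoid_closure (hom_vector G ` Hom G H)" if "set_mset A \<subseteq> Hom G H" for A
    using that by (induction A) (auto intro: monoid_closure.intros)
  then show "?R \<subseteq> ?L"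
    by (auto simp: hom_semigroup_def hom_exponents_eq[OF assms])
qed

lemma group_closure_hom_semigroup:
  assumes "is_graph G"
  shows "group_closure (hom_semigroup TYPE('k :: field) G H)
    = {hom_sum G A - hom_sum G B | A B. set_mset A \<subseteq> Hom G H \<and> set_mset B \<subseteq> Hom G H}"
    (is "?L = ?R")
proof
  show "?L \<subseteq> ?R"
  proof
    fix x assume "x \<in> ?L"
    then show "x \<in> ?R"
    proof induction
      case (base s)
      then obtain A where "set_mset A \<subseteq> Hom G H" "s = hom_sum G A"
        unfolding hom_semigroup_eq[OF assms]
        by (metis (no_types, lifting) empty_subsetI hom_sum_simps(1) imageE insertE mem_Collect_eq
            set_mset_empty)
      then show ?case
        by (intro CollectI exI[of _ A] exI[of _ "{#}"]) simp
    next
      case (diff s t)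
      then obtain A B C D where "set_mset A \<subseteq> Hom G H" "set_mset B \<subseteq> Hom G H"
        "set_mset C \<subseteq> Hom G H" "set_mset D \<subseteq> Hom G H"
        "s = hom_sum G A - hom_sum G B" "t = hom_sum G C - hom_sum G D" by blast
      then show ?case
        by (intro CollectI exI[of _ "A + D"] exI[of _ "B + C"]) simp
    qed
  qed
next
  show "?R \<subseteq> ?L"
    unfolding hom_semigroup_eq[OF assms]
    by (blast intro: group_closure.intros)
qed

text \<open>An element of the generated group is a difference of two sums of homomorphism vectors; it is
  encoded by the pair of multisets of homomorphisms.\<close>

lemma hom_ideal_normal_iff:
  assumes "is_graph G"
  shows "hom_ideal_normal TYPE('k :: field) G H \<longleftrightarrow>
    (\<forall>A B C. \<forall>n\<ge>1.
       set_mset A \<subseteq> Hom G H \<longrightarrow> set_mset B \<subseteq> Hom G H \<longrightarrow> set_mset C \<subseteq> Hom G H \<longrightarrow>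
       (\<forall>e\<in>edges G. repeat_mset n (edge_types A e)
          = repeat_mset n (edge_types B e) + edge_types C e) \<longrightarrow>
       (\<exists>D. set_mset D \<subseteq> Hom G H \<and> (\<forall>e\<in>edges G. edge_types A e = edge_types B e + edge_types D e)))"
    (is "?L \<longleftrightarrow> ?R")
proof
  assume L: ?L
  show ?R
  proof (intro allI impI)
    fix A B C :: "('a \<Rightarrow> 'b) multiset" and n :: nat
    assume n: "n \<ge> 1"
      and A: "set_mset A \<subseteq> Hom G H" and B: "set_mset B \<subseteq> Hom G H" and C: "set_mset C \<subseteq> Hom G H"
      and "\<forall>e\<in>edges G. repeat_mset n (edge_types A e)
          = repeat_mset n (edge_types B e) + edge_types C e"
    then have "hom_sum G (repeat_mset n A) = hom_sum G (repeat_mset n B + C)"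
      unfolding hom_sum_eq_iff[OF assms] by simp
    then have "frag_cmul (int n) (hom_sum G A - hom_sum G B) = hom_sum G C"
      by (simp add: poly_mapping_eq_iff fun_eq_iff lookup_add lookup_minus algebra_simps)
    moreover have "hom_sum G A - hom_sum G B \<in> group_closure (hom_semigroup TYPE('k) G H)"
      unfolding group_closure_hom_semigroup[OF assms] using A B by blast
    moreover have "hom_sum G C \<in> hom_semigroup TYPE('k) G H"
      unfolding hom_semigroup_eq[OF assms] using C by blast
    moreover have "int n \<ge> 1" using n by simp
    ultimately have "hom_sum G A - hom_sum G B \<in> hom_semigroup TYPE('k) G H"
      using L unfolding hom_ideal_normal_def normal_semigroup_def by metis
    then obtain D where D: "set_mset D \<subseteq> Hom G H" "hom_sum G A - hom_sum G B = hom_sum G D"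
      unfolding hom_semigroup_eq[OF assms] by blast
    then have "hom_sum G A = hom_sum G (B + D)" by (simp add: algebra_simps)
    with D(1) show "\<exists>D. set_mset D \<subseteq> Hom G H \<and>
        (\<forall>e\<in>edges G. edge_types A e = edge_types B e + edge_types D e)"
      unfolding hom_sum_eq_iff[OF assms] by auto
  qed
next
  assume R: ?R
  show ?L
    unfolding hom_ideal_normal_def normal_semigroup_def
  proof (intro ballI allI impI)
    fix q and n :: int
    assume q: "q \<in> group_closure (hom_semigroup TYPE('k) G H)" and n: "n \<ge> 1"
      and nq: "frag_cmul n q \<in> hom_semigroup TYPE('k) G H"
    obtain A B where AB: "set_mset A \<subseteq> Hom G H" "set_mset B \<subseteq> Hom G H"
      and q_eq: "q = hom_sum G A - hom_sum G B"
      using q unfolding group_closure_hom_semigroup[OF assms] by blast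
    obtain C where C: "set_mset C \<subseteq> Hom G H" and nq_eq: "frag_cmul n q = hom_sum G C"
      using nq unfolding hom_semigroup_eq[OF assms] by blast
    have "hom_sum G (repeat_mset (nat n) A) = hom_sum G (repeat_mset (nat n) B + C)"
      using n unfolding hom_sum_simps hom_sum_repeat nq_eq[symmetric] q_eq
      by (intro poly_mapping_eqI) (simp add: lookup_add lookup_minus algebra_simps)
    then have "\<forall>e\<in>edges G. repeat_mset (nat n) (edge_types A e)
          = repeat_mset (nat n) (edge_types B e) + edge_types C e"
      unfolding hom_sum_eq_iff[OF assms] by simp
    moreover have "nat n \<ge> 1" using n by simp
    ultimately obtain D where D: "set_mset D \<subseteq> Hom G H"
      and "\<forall>e\<in>edges G. edge_types A e = edge_types B e + edge_types D e"
      using R[rule_format, of "nat n" A B C] AB C by blast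
    then have "hom_sum G A = hom_sum G (B + D)" unfolding hom_sum_eq_iff[OF assms] by simp
    then have "q = hom_sum G D" by (simp add: q_eq)
    then show "q \<in> hom_semigroup TYPE('k) G H"
      unfolding hom_semigroup_eq[OF assms] using D by blast
  qed
qed

section \<open>Completions on subgraphs and gluing\<close>

definition homs_on :: "'a set \<Rightarrow> 'a set set \<Rightarrow> 'b graph \<Rightarrow> ('a \<Rightarrow> 'b) set" where
  "homs_on W F H = {\<phi>. \<phi> ` W \<subseteq> vertices H \<and> (\<forall>e\<in>F. \<phi> ` e \<in> edges H)}"

definition completable ::
  "'a set \<Rightarrow> 'a set set \<Rightarrow> 'b graph \<Rightarrow> ('a \<Rightarrow> 'b) multiset \<Rightarrow> ('a \<Rightarrow> 'b) multiset \<Rightarrow> bool" where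
  "completable W F H A B \<longleftrightarrow>
     (\<exists>D. set_mset D \<subseteq> homs_on W F H \<and> (\<forall>e\<in>F. edge_types A e = edge_types B e + edge_types D e))"

lemma completable_Un:
  assumes "completable W1 F1 H A B" "completable W2 F2 H A B"
    and "e \<in> F1" "e \<in> F2" "W1 \<inter> W2 \<subseteq> e" "\<Union>F1 \<subseteq> W1" "\<Union>F2 \<subseteq> W2"
  shows "completable (W1 \<union> W2) (F1 \<union> F2) H A B"
proof -
  obtain D1 where D1: "set_mset D1 \<subseteq> homs_on W1 F1 H"
    "\<forall>e\<in>F1. edge_types A e = edge_types B e + edge_types D1 e"
    using assms(1) unfolding completable_def by blast
  obtain D2 where D2: "set_mset D2 \<subseteq> homs_on W2 F2 H"
    "\<forall>e\<in>F2. edge_types A e = edge_types B e + edge_types D2 e"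
    using assms(2) unfolding completable_def by blast
  have "edge_types D1 e = edge_types D2 e"
    using D1(2) D2(2) assms(3,4) by (metis add_left_imp_eq)
  then have "rel_mset (=) (edge_types D1 e) (edge_types D2 e)"
    by (simp only: multiset.rel_eq)
  then have "rel_mset (\<lambda>\<phi> \<psi>. restrict \<phi> e = restrict \<psi> e) D1 D2"
    by (simp only: edge_types_def multiset.rel_map)
  then obtain Z where Z: "set_mset Z \<subseteq> {(\<phi>, \<psi>). restrict \<phi> e = restrict \<psi> e}"
    "image_mset fst Z = D1" "image_mset snd Z = D2"
    unfolding multiset.in_rel by blast
  define glue :: "('a \<Rightarrow> 'b) \<times> ('a \<Rightarrow> 'b) \<Rightarrow> 'a \<Rightarrow> 'b"
    where "glue z = (\<lambda>v. if v \<in> W1 then fst z v else snd z v)" for z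
  have glue1: "glue z v = fst z v" if "v \<in> W1" for z v
    using that by (simp add: glue_def)
  have glue2: "glue z v = snd z v" if "z \<in># Z" "v \<in> W2" for z v
  proof (cases "v \<in> W1")
    case True
    with that assms(5) have "v \<in> e" by blast
    moreover have "restrict (fst z) e = restrict (snd z) e" using that Z(1) by force
    ultimately show ?thesis using True by (metis glue1 restrict_apply')
  qed (simp add: glue_def)
  define D where "D = image_mset glue Z"
  have types1: "edge_types D e' = edge_types D1 e'" if "e' \<in> F1" for e'
  proof -
    have "restrict (glue z) e' = restrict (fst z) e'" for z
      using that assms(6) glue1 by (intro restrict_ext) blast
    then show ?thesis
      by (simp add: D_def edge_types_def Z(2)[symmetric] multiset.map_comp comp_def)
  qed
  have types2: "edge_types D e' = edge_types D2 e'" if "e' \<in> F2" for e'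
  proof -
    have "restrict (glue z) e' = restrict (snd z) e'" if "z \<in># Z" for z
      using that \<open>e' \<in> F2\<close> assms(7) glue2 by (intro restrict_ext) blast
    then show ?thesis
      by (simp add: D_def edge_types_def Z(3)[symmetric] multiset.map_comp comp_def
          cong: image_mset_cong)
  qed
  have "glue z \<in> homs_on (W1 \<union> W2) (F1 \<union> F2) H" if z: "z \<in># Z" for z
  proof -
    have "fst z \<in># D1" "snd z \<in># D2" using z Z(2,3) by auto
    then have "fst z \<in> homs_on W1 F1 H" "snd z \<in> homs_on W2 F2 H" using D1(1) D2(1) by auto
    moreover have img1: "glue z ` X = fst z ` X" if "X \<subseteq> W1" for X
      by (rule image_cong[OF refl]) (use that in \<open>blast intro: glue1\<close>)
    moreover have img2: "glue z ` X = snd z ` X" if "X \<subseteq> W2" for X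
      by (rule image_cong[OF refl]) (use that in \<open>blast intro: glue2[OF z]\<close>)
    moreover have "glue z ` e' = fst z ` e'" if "e' \<in> F1" for e'
      by (rule img1) (use that assms(6) in blast)
    moreover have "glue z ` e' = snd z ` e'" if "e' \<in> F2" for e'
      by (rule img2) (use that assms(7) in blast)
    ultimately show ?thesis
      by (simp add: homs_on_def image_Un ball_Un)
  qed
  then have "set_mset D \<subseteq> homs_on (W1 \<union> W2) (F1 \<union> F2) H" by (auto simp: D_def)
  moreover have "\<forall>e'\<in>F1 \<union> F2. edge_types A e' = edge_types B e' + edge_types D e'"
    using types1 types2 D1(2) D2(2) by auto
  ultimately show ?thesis unfolding completable_def by blast
qed

lemma completable_edge:
  assumes H: "is_graph H" and e: "e \<in> edges G" "e \<subseteq> vertices G"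
    and A: "set_mset A \<subseteq> Hom G H"
    and n: "n \<ge> 1" "repeat_mset n (edge_types A e)
          = repeat_mset n (edge_types B e) + C"
  shows "completable e {e} H A B"
proof -
  have sub: "edge_types B e \<subseteq># edge_types A e"
  proof (rule mset_subset_eqI)
    fix \<xi>
    have "n * count (edge_types B e) \<xi> \<le> n * count (edge_types A e) \<xi>"
      using arg_cong[OF n(2), of "\<lambda>M. count M \<xi>"] by simp
    then show "count (edge_types B e) \<xi> \<le> count (edge_types A e) \<xi>" using n(1) by simp
  qed
  define D where "D = edge_types A e - edge_types B e"
  have D: "\<exists>\<phi>\<in>Hom G H. \<xi> = restrict \<phi> e" if "\<xi> \<in># D" for \<xi>
    using in_diffD[OF that[unfolded D_def]] A by (auto simp: edge_types_def)
  then have "set_mset D \<subseteq> homs_on e {e} H"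
    using e H by (fastforce simp: homs_on_def Hom_def is_graph_def)
  moreover have "edge_types D e = D"
  proof -
    have "restrict \<xi> e = \<xi>" if "\<xi> \<in># D" for \<xi>
      using D[OF that] by auto
    then have "edge_types D e = image_mset id D"
      unfolding edge_types_def by (intro image_mset_cong) simp
    then show ?thesis by simp
  qed
  then have "edge_types A e = edge_types B e + edge_types D e"
    using sub by (simp add: D_def)
  ultimately show ?thesis unfolding completable_def by blast
qed

lemma completable_triangle:
  fixes G :: "'a graph" and H :: "'b graph"
  assumes K3: "hom_ideal_normal TYPE('k :: field) K3 H"
    and W: "W \<subseteq> vertices G" "card W = 3"
    and F: "\<And>e. e \<subseteq> W \<Longrightarrow> card e = 2 \<Longrightarrow> e \<in> edges G"
    and A: "set_mset A \<subseteq> Hom G H" and B: "set_mset B \<subseteq> Hom G H" and C: "set_mset C \<subseteq> Hom G H"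
    and n: "n \<ge> 1" "\<And>e. e \<in> edges G \<Longrightarrow> repeat_mset n (edge_types A e)
          = repeat_mset n (edge_types B e) + edge_types C e"
  shows "completable W {e. e \<subseteq> W \<and> card e = 2} H A B"
proof -
  let ?V = "{0, 1, 2 :: nat}"
  have "finite W" using W(2) by (metis card.infinite zero_neq_numeral)
  then obtain \<sigma> where \<sigma>: "bij_betw \<sigma> ?V W"
    using W(2) finite_same_card_bij[of ?V W] by auto
  define \<tau> where "\<tau> = inv_into ?V \<sigma>"
  have \<tau>: "bij_betw \<tau> W ?V" using \<sigma> unfolding \<tau>_def by (rule bij_betw_inv_into)
  have \<sigma>_edge: "\<sigma> ` e \<subseteq> W \<and> card (\<sigma> ` e) = 2" if "e \<in> edges K3" for e
    using that \<sigma> card_image[OF inj_on_subset[OF bij_betw_imp_inj_on[OF \<sigma>]], of e]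
      bij_betw_imp_surj_on[OF \<sigma>] image_mono[of e ?V \<sigma>]
    by (simp add: complete_graph_def)
  have \<tau>_edge: "\<tau> ` e \<in> edges K3" if "e \<subseteq> W" "card e = 2" for e
    using that \<tau> card_image[OF inj_on_subset[OF bij_betw_imp_inj_on[OF \<tau>]], of e]
      bij_betw_imp_surj_on[OF \<tau>] image_mono[of e W \<tau>]
    by (simp add: complete_graph_def)
  have \<sigma>\<tau>: "\<sigma> (\<tau> v) = v" if "v \<in> W" for v
    unfolding \<tau>_def using that \<sigma> by (simp add: bij_betw_def f_inv_into_f)
  define pull where "pull M = {#restrict (\<phi> \<circ> \<sigma>) ?V. \<phi> \<in># M#}" for M :: "('a \<Rightarrow> 'b) multiset"
  have pull_hom: "set_mset (pull M) \<subseteq> Hom K3 H" if M: "set_mset M \<subseteq> Hom G H" for M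
  proof
    fix \<psi> assume "\<psi> \<in># pull M"
    then obtain \<phi> where "\<phi> \<in> Hom G H" and \<psi>: "\<psi> = restrict (\<phi> \<circ> \<sigma>) ?V"
      using M by (auto simp: pull_def)
    then have \<phi>: "\<phi> ` vertices G \<subseteq> vertices H" "\<And>e. e \<in> edges G \<Longrightarrow> \<phi> ` e \<in> edges H"
      by (auto simp: Hom_def)
    have "\<psi> \<in> ?V \<rightarrow>\<^sub>E vertices H"
      unfolding \<psi> using \<phi>(1) W(1) bij_betw_imp_surj_on[OF \<sigma>] by auto
    moreover have "\<psi> ` e \<in> edges H" if e: "e \<in> edges K3" for e
    proof -
      have "\<psi> ` e = \<phi> ` \<sigma> ` e"
        unfolding \<psi> image_image using e
        by (intro image_cong) (auto simp: complete_graph_def)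
      then show ?thesis using \<phi>(2) F \<sigma>_edge[OF e] by simp
    qed
    ultimately show "\<psi> \<in> Hom K3 H"
      by (simp add: Hom_def complete_graph_def)
  qed
  have pull_types: "edge_types (pull M) e
      = {#restrict (\<xi> \<circ> \<sigma>) e. \<xi> \<in># edge_types M (\<sigma> ` e)#}" if "e \<in> edges K3" for M e
    using that edge_types_restrict[of e ?V "\<lambda>\<phi>. \<phi> \<circ> \<sigma>" M] edge_types_comp[of \<sigma> M e]
    by (simp add: pull_def complete_graph_def)
  have repeat_image: "repeat_mset m (image_mset f M) = image_mset f (repeat_mset m M)"
    for m and f :: "('a \<Rightarrow> 'b) \<Rightarrow> nat \<Rightarrow> 'b" and M
    by (induction m) simp_all
  have "\<forall>e\<in>edges K3. repeat_mset n (edge_types (pull A) e)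
      = repeat_mset n (edge_types (pull B) e) + edge_types (pull C) e"
  proof
    fix e assume e: "e \<in> edges K3"
    show "repeat_mset n (edge_types (pull A) e)
      = repeat_mset n (edge_types (pull B) e) + edge_types (pull C) e"
      unfolding pull_types[OF e] repeat_image image_mset_union[symmetric]
      using n(2)[OF F] \<sigma>_edge[OF e] by simp
  qed
  note types_eq = bspec[OF this]
  have "is_graph K3"
    by (auto simp: is_graph_def complete_graph_def)
  note normal = K3[unfolded hom_ideal_normal_iff[OF this], rule_format]
  obtain D' where D': "set_mset D' \<subseteq> Hom K3 H"
    and D'_eq: "\<forall>e\<in>edges K3. edge_types (pull A) e = edge_types (pull B) e + edge_types D' e"
    using normal[OF n(1) pull_hom[OF A] pull_hom[OF B] pull_hom[OF C] types_eq] by blast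
  define push where "push M = {#\<phi> \<circ> \<tau>. \<phi> \<in># M#}" for M :: "(nat \<Rightarrow> 'b) multiset"
  have push_types: "edge_types (push (pull M)) e = edge_types M e"
    if e: "e \<subseteq> W" "card e = 2" for M e
  proof -
    have "restrict (restrict (\<phi> \<circ> \<sigma>) ?V \<circ> \<tau>) e = restrict \<phi> e" for \<phi> :: "'a \<Rightarrow> 'b"
    proof (rule restrict_ext)
      fix v assume "v \<in> e"
      then have "v \<in> W" using e by blast
      then have "\<tau> v \<in> ?V" "\<sigma> (\<tau> v) = v" by (fact bij_betw_apply[OF \<tau>], fact \<sigma>\<tau>)
      then show "(restrict (\<phi> \<circ> \<sigma>) ?V \<circ> \<tau>) v = \<phi> v" by simp
    qed
    then show ?thesis
      by (simp only: push_def pull_def edge_types_def multiset.map_comp comp_def)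
  qed
  have "set_mset (push D') \<subseteq> homs_on W {e. e \<subseteq> W \<and> card e = 2} H"
  proof
    fix \<psi> assume "\<psi> \<in># push D'"
    then obtain \<phi> where "\<phi> \<in> Hom K3 H" and \<psi>: "\<psi> = \<phi> \<circ> \<tau>"
      using D' by (auto simp: push_def)
    then have \<phi>: "\<phi> ` ?V \<subseteq> vertices H" "\<And>e. e \<in> edges K3 \<Longrightarrow> \<phi> ` e \<in> edges H"
      by (auto simp: Hom_def complete_graph_def)
    have image: "\<psi> ` W = \<phi> ` ?V" "\<And>e. \<psi> ` e = \<phi> ` \<tau> ` e"
      unfolding \<psi> image_comp[symmetric] bij_betw_imp_surj_on[OF \<tau>] by (rule refl)+
    have "\<psi> ` W \<subseteq> vertices H" unfolding image(1) by (fact \<phi>(1))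
    moreover have "\<psi> ` e \<in> edges H" if "e \<subseteq> W" "card e = 2" for e
      unfolding image(2) by (intro \<phi>(2) \<tau>_edge that)
    ultimately show "\<psi> \<in> homs_on W {e. e \<subseteq> W \<and> card e = 2} H"
      by (simp add: homs_on_def)
  qed
  moreover have "edge_types A e = edge_types B e + edge_types (push D') e"
    if e: "e \<subseteq> W" "card e = 2" for e
  proof -
    have "edge_types (pull A) (\<tau> ` e) = edge_types (pull B) (\<tau> ` e) + edge_types D' (\<tau> ` e)"
      using D'_eq \<tau>_edge[OF e] by blast
    then have "edge_types (push (pull A)) e
        = edge_types (push (pull B)) e + edge_types (push D') e"
      by (simp only: push_def edge_types_comp image_mset_union)
    then show ?thesis by (simp only: push_types[OF e])
  qed
  ultimately show ?thesis unfolding completable_def by (intro exI[of _ "push D'"]) simp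
qed


section \<open>Chords of a circle\<close>

text \<open>Twice the signed area of the triangle \<open>p q z\<close>.\<close>

definition orient :: "complex \<Rightarrow> complex \<Rightarrow> complex \<Rightarrow> real" where
  "orient p q z = Im (cnj (q - p) * (z - p))"

lemma orient_same [simp]: "orient p q p = 0" "orient p q q = 0"
  by (simp_all add: orient_def algebra_simps)

lemma orient_affine:
  "orient p q ((1 - t) *\<^sub>R x + t *\<^sub>R y) = (1 - t) * orient p q x + t * orient p q y"
  by (simp add: orient_def algebra_simps)

lemma orient_affine_dependence:
  "orient x b y *\<^sub>R a + orient a x y *\<^sub>R b = orient a b y *\<^sub>R x + orient a x b *\<^sub>R y"
  "orient x b y + orient a x y = orient a b y + orient a x b"
  by (simp_all add: orient_def complex_eq_iff algebra_simps)

lemma sin_add_sin_minus_sin: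
  fixes u v :: real
  shows "sin (2 * u) + sin (2 * v) - sin (2 * u + 2 * v) = 4 * sin u * sin v * sin (u + v)"
proof -
  have "cos u ^ 2 = 1 - sin u ^ 2" "cos v ^ 2 = 1 - sin v ^ 2" by (simp_all add: cos_squared_eq)
  then show ?thesis
    unfolding sin_add cos_add sin_double cos_double by algebra
qed

lemma orient_circle:
  "orient (c + rcis r \<alpha>) (c + rcis r \<beta>) (c + rcis r \<gamma>)
    = 4 * r\<^sup>2 * sin ((\<beta> - \<alpha>) / 2) * sin ((\<gamma> - \<beta>) / 2) * sin ((\<gamma> - \<alpha>) / 2)"
proof -
  have "orient (c + rcis r \<alpha>) (c + rcis r \<beta>) (c + rcis r \<gamma>)
      = r\<^sup>2 * (sin (\<beta> - \<alpha>) + sin (\<gamma> - \<beta>) - sin (\<gamma> - \<alpha>))"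
    by (simp add: orient_def sin_diff algebra_simps power2_eq_square)
  also have "\<dots> = r\<^sup>2 * (4 * sin ((\<beta> - \<alpha>) / 2) * sin ((\<gamma> - \<beta>) / 2) * sin ((\<gamma> - \<alpha>) / 2))"
    using sin_add_sin_minus_sin[of "(\<beta> - \<alpha>) / 2" "(\<gamma> - \<beta>) / 2"]
    by (simp add: add_divide_distrib[symmetric] del: distrib_left_numeral right_diff_distrib_numeral)
  finally show ?thesis by simp
qed

lemma sin_half_pos: "0 < x \<Longrightarrow> x < 2 * pi \<Longrightarrow> 0 < sin (x / 2)" for x :: real
  by (intro sin_gt_zero) auto

lemma sin_half_neg: "x < 0 \<Longrightarrow> - (2 * pi) < x \<Longrightarrow> sin (x / 2) < 0" for x :: real
  using sin_half_pos[of "- x"] by simp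

lemma orient_circle_pos:
  assumes "r > 0" "{\<alpha>, \<beta>, \<gamma>} \<subseteq> {-pi<..pi}" "\<alpha> < \<beta>" "\<gamma> < \<alpha> \<or> \<beta> < \<gamma>"
  shows "orient (c + rcis r \<alpha>) (c + rcis r \<beta>) (c + rcis r \<gamma>) > 0"
proof -
  have "sin ((\<beta> - \<alpha>) / 2) > 0" using assms by (intro sin_half_pos) auto
  moreover have "sin ((\<gamma> - \<beta>) / 2) * sin ((\<gamma> - \<alpha>) / 2) > 0"
    using assms(4)
  proof
    assume "\<gamma> < \<alpha>"
    then show ?thesis using assms by (intro mult_neg_neg sin_half_neg) auto
  next
    assume "\<beta> < \<gamma>"
    then show ?thesis using assms by (intro mult_pos_pos sin_half_pos) auto
  qed
  ultimately show ?thesis using assms(1) by (simp add: orient_circle mult.assoc)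
qed

lemma orient_circle_neg:
  assumes "r > 0" "{\<alpha>, \<beta>, \<gamma>} \<subseteq> {-pi<..pi}" "\<alpha> < \<gamma>" "\<gamma> < \<beta>"
  shows "orient (c + rcis r \<alpha>) (c + rcis r \<beta>) (c + rcis r \<gamma>) < 0"
proof -
  have "sin ((\<beta> - \<alpha>) / 2) > 0" "sin ((\<gamma> - \<alpha>) / 2) > 0"
    using assms by (auto intro!: sin_half_pos)
  moreover have "sin ((\<gamma> - \<beta>) / 2) < 0"
    using assms by (intro sin_half_neg) auto
  ultimately show ?thesis
    using assms(1) unfolding orient_circle
    by (intro mult_neg_pos mult_pos_neg mult_pos_pos) auto
qed

lemma interleaving_chords_meet:
  assumes r: "r > 0" and *: "{\<alpha>, \<xi>, \<beta>, \<eta>} \<subseteq> {-pi<..pi}" "\<alpha> < \<xi>" "\<xi> < \<beta>" "\<beta> < \<eta>"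
  shows "closed_segment (c + rcis r \<alpha>) (c + rcis r \<beta>)
    \<inter> closed_segment (c + rcis r \<xi>) (c + rcis r \<eta>) \<noteq> {}"
proof -
  define a b x y where "a = c + rcis r \<alpha>" and "b = c + rcis r \<beta>"
    and "x = c + rcis r \<xi>" and "y = c + rcis r \<eta>"
  note defs = a_def b_def x_def y_def
  have pos: "orient x b y > 0" "orient a x y > 0" "orient a b y > 0" "orient a x b > 0"
    unfolding defs using * by (auto intro!: orient_circle_pos[OF r])
  define s where "s = orient x b y + orient a x y"
  have s: "s > 0" "s = orient a b y + orient a x b"
    using pos orient_affine_dependence(2)[of x b y a] by (simp_all add: s_def)
  define p where "p = (1 / s) *\<^sub>R (orient x b y *\<^sub>R a + orient a x y *\<^sub>R b)"
  have "p = (1 - orient a x y / s) *\<^sub>R a + (orient a x y / s) *\<^sub>R b"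
    using s(1) by (simp add: p_def s_def field_simps scaleR_add_right[symmetric])
  moreover have "p = (1 - orient a x b / s) *\<^sub>R x + (orient a x b / s) *\<^sub>R y"
    using s(1) unfolding p_def orient_affine_dependence(1) s(2)
    by (simp add: field_simps scaleR_add_right[symmetric])
  moreover have "0 \<le> orient a x y / s" "orient a x y / s \<le> 1"
    using pos by (simp_all add: s_def field_simps)
  moreover have "0 \<le> orient a x b / s" "orient a x b / s \<le> 1"
    using pos by (simp_all add: s(2) field_simps)
  ultimately have "p \<in> closed_segment a b" "p \<in> closed_segment x y"
    unfolding in_segment by blast+
  then show ?thesis by (auto simp: defs)
qed

lemma orient_segment: "z \<in> closed_segment p q \<Longrightarrow> orient p q z = 0"
  by (auto simp: in_segment orient_affine)

lemma segments_disjoint: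
  assumes "orient p q x > 0 \<and> orient p q y > 0 \<or> orient p q x < 0 \<and> orient p q y < 0"
  shows "closed_segment p q \<inter> closed_segment x y = {}"
proof (rule ccontr)
  assume "\<not> ?thesis"
  then obtain t where t: "0 \<le> t" "t \<le> 1" "(1 - t) * orient p q x + t * orient p q y = 0"
    by (metis (no_types, opaque_lifting) disjoint_iff in_segment(1) orient_affine orient_segment)
  show False
    using assms
  proof
    assume *: "orient p q x > 0 \<and> orient p q y > 0"
    have "0 \<le> (1 - t) * orient p q x" "0 \<le> t * orient p q y" using * t by auto
    then show False using * t by (cases "t = 0") (auto simp: add_nonneg_eq_0_iff)
  next
    assume *: "orient p q x < 0 \<and> orient p q y < 0"
    have "(1 - t) * orient p q x \<le> 0" "t * orient p q y \<le> 0"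
      using * t by (auto simp: mult_le_0_iff)
    then show False using * t by (cases "t = 0") (auto simp: add_nonpos_eq_0_iff)
  qed
qed

lemma segments_common_endpoint:
  assumes "orient p q y \<noteq> 0" "x = p \<or> x = q"
  shows "closed_segment p q \<inter> closed_segment x y \<subseteq> {x}"
proof
  fix z assume z: "z \<in> closed_segment p q \<inter> closed_segment x y"
  then obtain t where t: "z = (1 - t) *\<^sub>R x + t *\<^sub>R y" by (auto simp: in_segment)
  have "t * orient p q y = 0"
    using orient_segment[of z p q] z assms(2) unfolding t orient_affine by auto
  then show "z \<in> {x}" using assms(1) t by simp
qed

lemma noninterleaving_chords:
  assumes r: "r > 0" and f: "\<And>v. v \<in> V \<Longrightarrow> f v = c + rcis r (\<theta> v)"
    and \<theta>: "inj_on \<theta> V" "\<theta> ` V \<subseteq> {-pi<..pi}"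
    and V: "a \<in> V" "b \<in> V" "x \<in> V" "y \<in> V"
    and less: "\<theta> a < \<theta> b" "\<theta> x < \<theta> y" and ne: "{a, b} \<noteq> {x, y}"
    and nc: "\<not> (\<theta> a < \<theta> x \<and> \<theta> x < \<theta> b \<and> \<theta> b < \<theta> y)" "\<not> (\<theta> x < \<theta> a \<and> \<theta> a < \<theta> y \<and> \<theta> y < \<theta> b)"
  shows "convex hull (f ` {a, b}) \<inter> convex hull (f ` {x, y}) \<subseteq> f ` ({a, b} \<inter> {x, y})"
proof -
  have pos: "orient (f a) (f b) (f z) > 0" if "z \<in> V" "\<theta> z < \<theta> a \<or> \<theta> b < \<theta> z" for z
    using that V(1,2) \<theta>(2) less(1) by (simp add: f) (intro orient_circle_pos[OF r]; auto)
  have neg: "orient (f a) (f b) (f z) < 0" if "z \<in> V" "\<theta> a < \<theta> z" "\<theta> z < \<theta> b" for z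
    using that V(1,2) \<theta>(2) by (simp add: f) (intro orient_circle_neg[OF r]; auto)
  have \<theta>_ne: "\<theta> u \<noteq> \<theta> v" if "u \<in> V" "v \<in> V" "u \<noteq> v" for u v
    using that \<theta>(1) by (auto dest: inj_onD)
  have nz: "orient (f a) (f b) (f z) \<noteq> 0" if "z \<in> V" "z \<noteq> a" "z \<noteq> b" for z
    using pos[OF that(1)] neg[OF that(1)] \<theta>_ne[OF that(1) V(1)] \<theta>_ne[OF that(1) V(2)] that(2,3)
    by linarith
  have xy: "x \<noteq> y" using less(2) by auto
  have hull: "convex hull (f ` {u, v}) = closed_segment (f u) (f v)" for u v
    by (simp add: segment_convex_hull)
  consider "x \<in> {a, b}" | "y \<in> {a, b}" | "x \<notin> {a, b}" "y \<notin> {a, b}" by blast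
  then show ?thesis
  proof cases
    case 1
    then have "y \<noteq> a" "y \<noteq> b" using ne xy by auto
    then have "closed_segment (f a) (f b) \<inter> closed_segment (f x) (f y) \<subseteq> {f x}"
      using 1 V(4) by (intro segments_common_endpoint nz) auto
    with 1 show ?thesis unfolding hull by blast
  next
    case 2
    then have "x \<noteq> a" "x \<noteq> b" using ne xy by auto
    then have "closed_segment (f a) (f b) \<inter> closed_segment (f y) (f x) \<subseteq> {f y}"
      using 2 V(3) by (intro segments_common_endpoint nz) auto
    with 2 show ?thesis unfolding hull closed_segment_commute[of "f x"] by blast
  next
    case 3
    then have "\<theta> x \<noteq> \<theta> a" "\<theta> x \<noteq> \<theta> b" "\<theta> y \<noteq> \<theta> a" "\<theta> y \<noteq> \<theta> b"
      using V \<theta>_ne by auto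
    then have "orient (f a) (f b) (f x) > 0 \<and> orient (f a) (f b) (f y) > 0
        \<or> orient (f a) (f b) (f x) < 0 \<and> orient (f a) (f b) (f y) < 0"
      using pos[OF V(3)] pos[OF V(4)] neg[OF V(3)] neg[OF V(4)] nc less by argo
    then show ?thesis unfolding hull using segments_disjoint by blast
  qed
qed


section \<open>Maximal noncrossing sets of chords\<close>

locale maximal_noncrossing =
  fixes V :: "'a set" and E :: "'a set set" and \<theta> :: "'a \<Rightarrow> real"
  assumes finite_V: "finite V" and inj: "inj_on \<theta> V"
    and edgeE: "e \<in> E \<Longrightarrow> \<exists>a\<in>V. \<exists>b\<in>V. \<theta> a < \<theta> b \<and> e = {a, b}"
    and noncrossing: "{a, b} \<in> E \<Longrightarrow> {x, y} \<in> E \<Longrightarrow> \<not> (\<theta> a < \<theta> x \<and> \<theta> x < \<theta> b \<and> \<theta> b < \<theta> y)"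
    and maximal: "a \<in> V \<Longrightarrow> b \<in> V \<Longrightarrow> \<theta> a < \<theta> b \<Longrightarrow>
      (\<And>x y. {x, y} \<in> E \<Longrightarrow> \<not> (\<theta> a < \<theta> x \<and> \<theta> x < \<theta> b \<and> \<theta> b < \<theta> y)
        \<and> \<not> (\<theta> x < \<theta> a \<and> \<theta> a < \<theta> y \<and> \<theta> y < \<theta> b)) \<Longrightarrow> {a, b} \<in> E"
begin

lemma edge_in_V: "{x, y} \<in> E \<Longrightarrow> x \<in> V \<and> y \<in> V"
  using edgeE by (metis doubleton_eq_iff)

text \<open>The apex is the last neighbour \<open>k\<close> of \<open>i\<close> before \<open>j\<close>: an edge crossing \<open>{k, j}\<close> would cross
  \<open>{i, k}\<close> or \<open>{i, j}\<close>, or join \<open>i\<close> to a vertex beyond \<open>k\<close>.\<close>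

lemma apex:
  assumes ij: "{i, j} \<in> E" and v: "v \<in> V" "\<theta> i < \<theta> v" "\<theta> v < \<theta> j"
  obtains k where "k \<in> V" "\<theta> i < \<theta> k" "\<theta> k < \<theta> j" "{i, k} \<in> E" "{k, j} \<in> E"
proof -
  have V: "i \<in> V" "j \<in> V" using edge_in_V[OF ij] by auto
  define S where "S = {w \<in> V. \<theta> i < \<theta> w}"
  have S: "finite S" "S \<noteq> {}" using finite_V v by (auto simp: S_def)
  obtain m where "m \<in> S" "\<theta> m = Min (\<theta> ` S)" using obtains_MIN[where f = \<theta>, OF S] by metis
  then have m: "m \<in> V" "\<theta> i < \<theta> m" "\<And>w. w \<in> V \<Longrightarrow> \<theta> i < \<theta> w \<Longrightarrow> \<theta> m \<le> \<theta> w"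
    using S by (auto simp: S_def)
  have "{i, m} \<in> E"
  proof (rule maximal)
    fix x y assume "{x, y} \<in> E"
    then have "x \<in> V" "y \<in> V" using edge_in_V by auto
    then have "\<not> (\<theta> i < \<theta> x \<and> \<theta> x < \<theta> m)" "\<not> (\<theta> i < \<theta> y \<and> \<theta> y < \<theta> m)"
      using m(3)[of x] m(3)[of y] by auto
    then show "\<not> (\<theta> i < \<theta> x \<and> \<theta> x < \<theta> m \<and> \<theta> m < \<theta> y) \<and> \<not> (\<theta> x < \<theta> i \<and> \<theta> i < \<theta> y \<and> \<theta> y < \<theta> m)"
      by blast
  qed (use V m in auto)
  define K where "K = {k \<in> V. \<theta> i < \<theta> k \<and> \<theta> k < \<theta> j \<and> {i, k} \<in> E}"
  have "m \<in> K" using m v(3) m(3)[OF v(1,2)] \<open>{i, m} \<in> E\<close> by (simp add: K_def)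
  then have K: "finite K" "K \<noteq> {}" using finite_V by (auto simp: K_def)
  obtain k where "k \<in> K" "\<theta> k = Max (\<theta> ` K)" using obtains_MAX[where f = \<theta>, OF K] by metis
  then have k: "k \<in> K" "\<And>w. w \<in> K \<Longrightarrow> \<theta> w \<le> \<theta> k" using K(1) by simp_all
  have kj: "{k, j} \<in> E"
  proof (rule maximal)
    fix x y assume xy: "{x, y} \<in> E"
    then have xyV: "x \<in> V" "y \<in> V" using edge_in_V by auto
    have "\<not> (\<theta> k < \<theta> x \<and> \<theta> x < \<theta> j \<and> \<theta> j < \<theta> y)"
      using noncrossing[OF ij xy] k(1) by (auto simp: K_def)
    moreover have "\<not> (\<theta> x < \<theta> k \<and> \<theta> k < \<theta> y \<and> \<theta> y < \<theta> j)"
    proof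
      assume *: "\<theta> x < \<theta> k \<and> \<theta> k < \<theta> y \<and> \<theta> y < \<theta> j"
      consider "\<theta> x < \<theta> i" | "\<theta> x = \<theta> i" | "\<theta> i < \<theta> x" by linarith
      then show False
      proof cases
        case 1
        then show False using noncrossing[OF xy ij] * k(1) by (auto simp: K_def)
      next
        case 2
        then have "x = i" using inj V xyV by (auto dest: inj_onD)
        then have "y \<in> K" using xy xyV * k(1) by (auto simp: K_def)
        then show False using k(2) * by fastforce
      next
        case 3
        then show False using noncrossing[OF _ xy, of i k] * k(1) by (auto simp: K_def)
      qed
    qed
    ultimately show "\<not> (\<theta> k < \<theta> x \<and> \<theta> x < \<theta> j \<and> \<theta> j < \<theta> y)
        \<and> \<not> (\<theta> x < \<theta> k \<and> \<theta> k < \<theta> y \<and> \<theta> y < \<theta> j)" by blast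
  qed (use V k(1) in \<open>auto simp: K_def\<close>)
  show thesis by (rule that[of k]) (use k(1) kj in \<open>auto simp: K_def\<close>)
qed

definition interval :: "'a \<Rightarrow> 'a \<Rightarrow> 'a set" where
  "interval i j = {v \<in> V. \<theta> i \<le> \<theta> v \<and> \<theta> v \<le> \<theta> j}"

lemma edges_interval_split:
  assumes ij: "{i, j} \<in> E" and k: "\<theta> i < \<theta> k" "\<theta> k < \<theta> j" "{i, k} \<in> E" "{k, j} \<in> E"
  shows "{e \<in> E. e \<subseteq> interval i j} = {e. e \<subseteq> {i, k, j} \<and> card e = 2}
    \<union> {e \<in> E. e \<subseteq> interval i k} \<union> {e \<in> E. e \<subseteq> interval k j}" (is "?L = ?R")
proof
  have V: "i \<in> V" "j \<in> V" "k \<in> V" using edge_in_V ij k by blast+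
  show "?L \<subseteq> ?R"
  proof
    fix e assume "e \<in> ?L"
    then have e: "e \<in> E" "e \<subseteq> interval i j" by auto
    obtain x y where xy: "x \<in> V" "y \<in> V" "\<theta> x < \<theta> y" "e = {x, y}" using edgeE[OF e(1)] by blast
    have le: "\<theta> i \<le> \<theta> x" "\<theta> y \<le> \<theta> j" using e(2) xy(4) by (auto simp: interval_def)
    consider "\<theta> y \<le> \<theta> k" | "\<theta> k \<le> \<theta> x" | "\<theta> x < \<theta> k" "\<theta> k < \<theta> y" by linarith
    then show "e \<in> ?R"
    proof cases
      case 1
      then have "e \<subseteq> interval i k" using xy le by (auto simp: interval_def)
      then show ?thesis using e(1) by blast
    next
      case 2
      then have "e \<subseteq> interval k j" using xy le by (auto simp: interval_def)
      then show ?thesis using e(1) by blast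
    next
      case 3
      have "\<theta> x = \<theta> i" using noncrossing[OF k(3), of x y] e(1) xy(4) 3 le by auto
      moreover have "\<theta> y = \<theta> j" using noncrossing[OF _ k(4), of x y] e(1) xy(4) 3 le by auto
      ultimately have "x = i" "y = j" using inj V xy(1,2) by (auto dest: inj_onD)
      then show ?thesis using xy(3,4) by (auto simp: card_2_iff)
    qed
  qed
next
  have V: "i \<in> V" "j \<in> V" "k \<in> V" using edge_in_V ij k by blast+
  have "e \<in> E" "e \<subseteq> interval i j" if e: "e \<subseteq> {i, k, j}" "card e = 2" for e
  proof -
    obtain x y where "e = {x, y}" "x \<noteq> y" using e(2) by (auto simp: card_2_iff)
    then show "e \<in> E" using e(1) ij k by (auto simp: insert_commute)
    show "e \<subseteq> interval i j" using e(1) V k by (auto simp: interval_def)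
  qed
  moreover have "interval i k \<subseteq> interval i j" "interval k j \<subseteq> interval i j"
    using k(1,2) by (auto simp: interval_def)
  ultimately show "?R \<subseteq> ?L" by blast
qed

lemma gluing_induct [consumes 1, case_names edge triangle glue]:
  assumes "E \<noteq> {}"
    and edge: "\<And>e. e \<in> E \<Longrightarrow> P e {e}"
    and triangle: "\<And>W. W \<subseteq> V \<Longrightarrow> card W = 3 \<Longrightarrow> (\<And>e. e \<subseteq> W \<Longrightarrow> card e = 2 \<Longrightarrow> e \<in> E) \<Longrightarrow>
      P W {e. e \<subseteq> W \<and> card e = 2}"
    and glue: "\<And>W1 F1 W2 F2 e. P W1 F1 \<Longrightarrow> P W2 F2 \<Longrightarrow> e \<in> F1 \<Longrightarrow> e \<in> F2 \<Longrightarrow> W1 \<inter> W2 \<subseteq> e \<Longrightarrow>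
      \<Union>F1 \<subseteq> W1 \<Longrightarrow> \<Union>F2 \<subseteq> W2 \<Longrightarrow> P (W1 \<union> W2) (F1 \<union> F2)"
  shows "P V E"
proof -
  have *: "P (interval i j) {e \<in> E. e \<subseteq> interval i j}" if "{i, j} \<in> E" "\<theta> i < \<theta> j" for i j
    using that
  proof (induction "card (interval i j)" arbitrary: i j rule: less_induct)
    case less
    have V: "i \<in> V" "j \<in> V" using edge_in_V less.prems by auto
    show ?case
    proof (cases "\<exists>v\<in>V. \<theta> i < \<theta> v \<and> \<theta> v < \<theta> j")
      case False
      have "v = i \<or> v = j" if "v \<in> interval i j" for v
        using that False inj V unfolding interval_def inj_on_def
        by (metis (mono_tags, lifting) mem_Collect_eq order_le_less)
      then have "interval i j = {i, j}"
        using V less.prems(2) by (auto simp: interval_def)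
      moreover have "{e \<in> E. e \<subseteq> {i, j}} = {{i, j}}"
      proof -
        have "e = {i, j}" if e: "e \<in> E" "e \<subseteq> {i, j}" for e
        proof -
          obtain a b where "\<theta> a < \<theta> b" "e = {a, b}" using edgeE[OF e(1)] by blast
          then show ?thesis using e(2) by auto
        qed
        then show ?thesis using less.prems(1) by blast
      qed
      ultimately show ?thesis using edge[OF less.prems(1)] by simp
    next
      case True
      then obtain k where k: "k \<in> V" "\<theta> i < \<theta> k" "\<theta> k < \<theta> j" "{i, k} \<in> E" "{k, j} \<in> E"
        using apex[OF less.prems(1)] by blast
      let ?T = "{i, k, j}"
      have fin: "finite (interval i j)" using finite_V by (simp add: interval_def)
      have "j \<in> interval i j - interval i k" "i \<in> interval i j - interval k j"
        "interval i k \<subseteq> interval i j" "interval k j \<subseteq> interval i j"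
        using k V by (auto simp: interval_def)
      then have sub: "interval i k \<subset> interval i j" "interval k j \<subset> interval i j" by blast+
      note IH = less.hyps[OF psubset_card_mono[OF fin sub(1)] k(4,2)]
        less.hyps[OF psubset_card_mono[OF fin sub(2)] k(5,3)]
      have split: "{e. e \<subseteq> ?T \<and> card e = 2} \<union> {e \<in> E. e \<subseteq> interval i k}
          \<union> {e \<in> E. e \<subseteq> interval k j} = {e \<in> E. e \<subseteq> interval i j}"
        using edges_interval_split[OF less.prems(1) k(2-5)] by simp
      have ne: "i \<noteq> k" "k \<noteq> j" "i \<noteq> j" using k by auto
      have T: "P ?T {e. e \<subseteq> ?T \<and> card e = 2}"
        by (rule triangle) (use V k ne split in auto)
      have "P (?T \<union> interval i k) ({e. e \<subseteq> ?T \<and> card e = 2} \<union> {e \<in> E. e \<subseteq> interval i k})"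
        by (rule glue[OF T IH(1), of "{i, k}"]) (use V k ne in \<open>auto simp: interval_def\<close>)
      then have "P (?T \<union> interval i k \<union> interval k j) ({e. e \<subseteq> ?T \<and> card e = 2}
          \<union> {e \<in> E. e \<subseteq> interval i k} \<union> {e \<in> E. e \<subseteq> interval k j})"
      proof (rule glue[OF _ IH(2), of _ _ "{k, j}"])
        have "v = k" if "v \<in> V" "\<theta> v = \<theta> k" for v
          using inj that k(1) by (auto dest: inj_onD)
        then show "(?T \<union> interval i k) \<inter> interval k j \<subseteq> {k, j}"
          using k by (auto simp: interval_def)
      qed (use V k ne in \<open>auto simp: interval_def\<close>)
      moreover have "?T \<union> interval i k \<union> interval k j = interval i j"
        using V k by (auto simp: interval_def)
      ultimately show ?thesis by (simp only: split)
    qed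
  qed
  obtain a b where ab: "a \<in> V" "b \<in> V" "\<theta> a < \<theta> b" using assms(1) edgeE by blast
  have ne: "V \<noteq> {}" using ab by blast
  obtain i where "i \<in> V" "\<theta> i = Min (\<theta> ` V)" using obtains_MIN[where f = \<theta>, OF finite_V ne] by metis
  then have i: "i \<in> V" "\<And>v. v \<in> V \<Longrightarrow> \<theta> i \<le> \<theta> v" using finite_V by simp_all
  obtain j where "j \<in> V" "\<theta> j = Max (\<theta> ` V)" using obtains_MAX[where f = \<theta>, OF finite_V ne] by metis
  then have j: "j \<in> V" "\<And>v. v \<in> V \<Longrightarrow> \<theta> v \<le> \<theta> j" using finite_V by simp_all
  have "\<theta> i < \<theta> j" using ab i(2)[of a] j(2)[of b] by linarith
  moreover have "{i, j} \<in> E"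
  proof (rule maximal)
    fix x y assume "{x, y} \<in> E"
    then have "x \<in> V" "y \<in> V" using edge_in_V by auto
    then have "\<theta> i \<le> \<theta> x" "\<theta> y \<le> \<theta> j" using i(2) j(2) by auto
    then show "\<not> (\<theta> i < \<theta> x \<and> \<theta> x < \<theta> j \<and> \<theta> j < \<theta> y) \<and> \<not> (\<theta> x < \<theta> i \<and> \<theta> i < \<theta> y \<and> \<theta> y < \<theta> j)"
      by auto
  qed (use i j \<open>\<theta> i < \<theta> j\<close> in auto)
  moreover have "interval i j = V" using i j by (auto simp: interval_def)
  moreover have "{e \<in> E. e \<subseteq> V} = E" using edgeE by fastforce
  ultimately show ?thesis using *[of i j] by simp
qed

end

lemma maximal_outerplanar_noncrossing:
  assumes "maximal_outerplanar G"
  obtains \<theta> where "maximal_noncrossing (vertices G) (edges G) \<theta>"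
proof -
  let ?V = "vertices G"
  have G: "is_graph G" "loopless G" using assms by (auto simp: maximal_outerplanar_def outerplanar_def)
  have max: "edges G' = edges G"
    if "outerplanar G'" "vertices G' = ?V" "edges G \<subseteq> edges G'" for G' :: "'a graph"
    using assms that by (simp add: maximal_outerplanar_def)
  have "outerplanar G" using assms by (simp add: maximal_outerplanar_def)
  then obtain f :: "'a \<Rightarrow> complex" and c r
    where "r > 0 \<and> inj_on f ?V \<and> f ` ?V \<subseteq> sphere c r \<and>
      (\<forall>e\<in>edges G. \<forall>e'\<in>edges G. e \<noteq> e' \<longrightarrow>
         convex hull (f ` e) \<inter> convex hull (f ` e') \<subseteq> f ` (e \<inter> e'))"
    unfolding outerplanar_def by (elim conjE exE) (rule that, intro conjI)
  then have r: "r > 0" and f: "inj_on f ?V" "f ` ?V \<subseteq> sphere c r"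
    and disjoint: "\<And>e e'. e \<in> edges G \<Longrightarrow> e' \<in> edges G \<Longrightarrow> e \<noteq> e' \<Longrightarrow>
      convex hull (f ` e) \<inter> convex hull (f ` e') \<subseteq> f ` (e \<inter> e')"
    by simp_all
  define \<theta> where "\<theta> v = Arg (f v - c)" for v
  have f_eq: "f v = c + rcis r (\<theta> v)" if "v \<in> ?V" for v
  proof -
    have "cmod (f v - c) = r" using that f(2) by (auto simp: dist_norm norm_minus_commute)
    then show ?thesis using rcis_cmod_Arg[of "f v - c"] by (simp add: \<theta>_def)
  qed
  have \<theta>: "inj_on \<theta> ?V" "\<theta> ` ?V \<subseteq> {-pi<..pi}"
  proof -
    show "inj_on \<theta> ?V" using f(1) f_eq by (auto simp: inj_on_def)
    show "\<theta> ` ?V \<subseteq> {-pi<..pi}" by (auto simp: \<theta>_def mpi_less_Arg Arg_le_pi)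
  qed
  have edgeE: "\<exists>a\<in>?V. \<exists>b\<in>?V. \<theta> a < \<theta> b \<and> e = {a, b}" if "e \<in> edges G" for e
  proof -
    have "card e = 2" "e \<subseteq> ?V" using that G by (auto simp: is_graph_def loopless_def)
    then obtain a b where "e = {a, b}" "a \<noteq> b" "a \<in> ?V" "b \<in> ?V" by (auto simp: card_2_iff)
    moreover have "\<theta> a \<noteq> \<theta> b" using calculation \<theta>(1) by (auto dest: inj_onD)
    ultimately show ?thesis by (metis insert_commute linorder_neqE)
  qed
  have "maximal_noncrossing ?V (edges G) \<theta>"
  proof
    show "finite ?V" using G by (simp add: is_graph_def)
    show "inj_on \<theta> ?V" by (fact \<theta>(1))
    show "\<exists>a\<in>?V. \<exists>b\<in>?V. \<theta> a < \<theta> b \<and> e = {a, b}" if "e \<in> edges G" for e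
      using edgeE[OF that] .
  next
    fix a b x y assume ab: "{a, b} \<in> edges G" and xy: "{x, y} \<in> edges G"
    then have V: "a \<in> ?V" "b \<in> ?V" "x \<in> ?V" "y \<in> ?V" using G by (auto simp: is_graph_def)
    show "\<not> (\<theta> a < \<theta> x \<and> \<theta> x < \<theta> b \<and> \<theta> b < \<theta> y)"
    proof
      assume *: "\<theta> a < \<theta> x \<and> \<theta> x < \<theta> b \<and> \<theta> b < \<theta> y"
      then have "{a, b} \<inter> {x, y} = {}" by auto
      then have "closed_segment (f a) (f b) \<inter> closed_segment (f x) (f y) = {}"
        using disjoint[OF ab xy] by (auto simp: segment_convex_hull)
      moreover have "{\<theta> a, \<theta> x, \<theta> b, \<theta> y} \<subseteq> {-pi<..pi}" using V \<theta>(2) by blast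
      ultimately show False
        using interleaving_chords_meet[OF r, of "\<theta> a" "\<theta> x" "\<theta> b" "\<theta> y" c] *
        by (simp add: f_eq V)
    qed
  next
    fix a b assume a: "a \<in> ?V" and b: "b \<in> ?V" and less: "\<theta> a < \<theta> b"
      and nc: "\<And>x y. {x, y} \<in> edges G \<Longrightarrow> \<not> (\<theta> a < \<theta> x \<and> \<theta> x < \<theta> b \<and> \<theta> b < \<theta> y)
        \<and> \<not> (\<theta> x < \<theta> a \<and> \<theta> a < \<theta> y \<and> \<theta> y < \<theta> b)"
    define G' where "G' = \<lparr>vertices = ?V, edges = insert {a, b} (edges G)\<rparr>"
    have card: "card {a, b} = 2" using less by (auto simp: card_2_iff)
    have new: "convex hull (f ` {a, b}) \<inter> convex hull (f ` e) \<subseteq> f ` ({a, b} \<inter> e)"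
      if e: "e \<in> edges G" "e \<noteq> {a, b}" for e
    proof -
      obtain x y where xy: "x \<in> ?V" "y \<in> ?V" "\<theta> x < \<theta> y" "e = {x, y}"
        using edgeE[OF e(1)] by blast
      then show ?thesis
        using noninterleaving_chords[OF r f_eq \<theta> a b xy(1,2) less xy(3)] nc[of x y] e by auto
    qed
    have "outerplanar G'"
      unfolding outerplanar_def
    proof (intro conjI)
      show "is_graph G'" using G(1) a b card by (auto simp: G'_def is_graph_def)
      show "loopless G'" using G(2) card by (auto simp: G'_def loopless_def)
      have "convex hull (f ` e) \<inter> convex hull (f ` e') \<subseteq> f ` (e \<inter> e')"
        if ee': "e \<in> edges G'" "e' \<in> edges G'" "e \<noteq> e'" for e e'
      proof -
        consider "e = {a, b}" "e' \<in> edges G" | "e' = {a, b}" "e \<in> edges G"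
          | "e \<in> edges G" "e' \<in> edges G"
          using ee' by (auto simp: G'_def)
        then show ?thesis
        proof cases
          case 1
          then show ?thesis using new[of e'] ee'(3) by blast
        next
          case 2
          then show ?thesis using new[of e] ee'(3) by (simp add: Int_commute)
        next
          case 3
          then show ?thesis using disjoint ee'(3) by blast
        qed
      qed
      then show "\<exists>(f :: 'a \<Rightarrow> complex) c r. r > 0 \<and> inj_on f (vertices G') \<and> f ` vertices G' \<subseteq> sphere c r \<and>
        (\<forall>e\<in>edges G'. \<forall>e'\<in>edges G'. e \<noteq> e' \<longrightarrow>
           convex hull (f ` e) \<inter> convex hull (f ` e') \<subseteq> f ` (e \<inter> e'))"
        using r f by (intro exI[of _ f] exI[of _ c] exI[of _ r]) (auto simp: G'_def)
    qed
    then have "edges G' = edges G" by (rule max) (auto simp: G'_def)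
    then show "{a, b} \<in> edges G" by (auto simp: G'_def)
  qed
  then show thesis by (rule that)
qed

theorem proposition6p4:
  fixes H :: "'b graph" and G :: "'a graph"
  assumes "is_graph H"
    and "hom_ideal_normal TYPE('k :: field) K3 H"
    and "maximal_outerplanar G"
  shows "hom_ideal_normal TYPE('k) G H"
proof -
  have G: "is_graph G" using assms(3) by (simp add: maximal_outerplanar_def outerplanar_def)
  obtain \<theta> where "maximal_noncrossing (vertices G) (edges G) \<theta>"
    using maximal_outerplanar_noncrossing[OF assms(3)] .
  then interpret maximal_noncrossing "vertices G" "edges G" \<theta> .
  show ?thesis
    unfolding hom_ideal_normal_iff[OF G]
  proof (intro allI impI)
    fix A B C :: "('a \<Rightarrow> 'b) multiset" and n :: nat
    assume n: "n \<ge> 1"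
      and A: "set_mset A \<subseteq> Hom G H" and B: "set_mset B \<subseteq> Hom G H" and C: "set_mset C \<subseteq> Hom G H"
      and eq: "\<forall>e\<in>edges G. repeat_mset n (edge_types A e)
          = repeat_mset n (edge_types B e) + edge_types C e"
    show "\<exists>D. set_mset D \<subseteq> Hom G H \<and>
        (\<forall>e\<in>edges G. edge_types A e = edge_types B e + edge_types D e)"
    proof (cases "edges G = {}")
      case True
      then show ?thesis by (intro exI[of _ "{#}"]) simp
    next
      case False
      then have "completable (vertices G) (edges G) H A B"
      proof (induction rule: gluing_induct)
        case (edge e)
        then show ?case
          using completable_edge[OF assms(1) _ _ A n bspec[OF eq]] G by (simp add: is_graph_def)
      next
        case (triangle W)
        then show ?case
          using completable_triangle[OF assms(2) _ _ _ A B C n bspec[OF eq]] by simp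
      next
        case (glue W1 F1 W2 F2 e)
        then show ?case by (rule completable_Un)
      qed
      then obtain D where D: "set_mset D \<subseteq> homs_on (vertices G) (edges G) H"
        "\<forall>e\<in>edges G. edge_types A e = edge_types B e + edge_types D e"
        unfolding completable_def by blast
      have sub: "e \<subseteq> vertices G" if "e \<in> edges G" for e
        using that G by (simp add: is_graph_def)
      define D' where "D' = {#restrict \<phi> (vertices G). \<phi> \<in># D#}"
      have "restrict \<phi> (vertices G) \<in> Hom G H" if "\<phi> \<in># D" for \<phi>
      proof -
        have "\<phi> \<in> homs_on (vertices G) (edges G) H" using that D(1) by blast
        moreover have "restrict \<phi> (vertices G) ` e = \<phi> ` e" if "e \<in> edges G" for e
          using sub[OF that] by (intro image_cong) auto
        ultimately show ?thesis by (auto simp: homs_on_def Hom_def)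
      qed
      then have "set_mset D' \<subseteq> Hom G H" by (auto simp: D'_def)
      moreover have "edge_types D' e = edge_types D e" if "e \<in> edges G" for e
        using edge_types_restrict[OF sub[OF that], of "\<lambda>\<phi>. \<phi>" D] by (simp add: D'_def)
      ultimately show ?thesis using D(2) by (intro exI[of _ D']) simp
    qed
  qed
qed

end
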